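(* Let $J$ be an algebra of cardinality $\kappa$ in a language of cardinality $\lambda$. If $\kappa > \lambda^+$ and the subalgebra lattice of $J$ is distributive, then $J$ has a proper subalgebra of cardinality $\kappa$.
   Context: An algebra is a set equipped with finitary operations interpreting the operation symbols of an algebraic language. The cardinality of a language is understood to be infinite, i.e. it is the maximum of $\aleph_0$ and the number of operation symbols (so a language with countably many symbols has cardinality $\lambda=\aleph_0$). $\lambda^+$ denotes the successor cardinal of $\lambda$. The subalgebra lattice of $J$ is the lattice of all subuniverses of $J$ (subsets closed under all operations) ordered by inclusion, with meet given by intersection and join given by the subalgebra generated by the union; as usual the empty set counts as a subuniverse when the language has no nullary operation symbols. A subalgebra of $J$ is proper if it is not all of $J$. *)

theory Defs
  imports Main HOL.Hull
begin

unbundle cardinal_syntax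

text \<open>An algebra is given by a set \<open>F\<close> of operation symbols with arities \<open>ar\<close>, a universe \<open>J\<close> and
  an interpretation \<open>I\<close>. An \<open>n\<close>-ary operation takes its arguments as a list of length \<open>n\<close>; the
  values of \<open>I\<close> on symbols outside \<open>F\<close>, or on lists of the wrong length or with entries outside
  \<open>J\<close>, are irrelevant.\<close>

definition closed_under ::
  "'f set \<Rightarrow> ('f \<Rightarrow> nat) \<Rightarrow> ('f \<Rightarrow> 'a list \<Rightarrow> 'a) \<Rightarrow> 'a set \<Rightarrow> bool" where
  "closed_under F ar I S \<longleftrightarrow>
     (\<forall>f\<in>F. \<forall>xs\<in>lists S. length xs = ar f \<longrightarrow> I f xs \<in> S)"

definition is_algebra ::
  "'f set \<Rightarrow> ('f \<Rightarrow> nat) \<Rightarrow> ('f \<Rightarrow> 'a list \<Rightarrow> 'a) \<Rightarrow> 'a set \<Rightarrow> bool" where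
  "is_algebra F ar I J \<longleftrightarrow> closed_under F ar I J"

text \<open>The empty set is a subuniverse exactly when no symbol in \<open>F\<close> has arity 0.\<close>

definition subuniverse ::
  "'f set \<Rightarrow> ('f \<Rightarrow> nat) \<Rightarrow> ('f \<Rightarrow> 'a list \<Rightarrow> 'a) \<Rightarrow> 'a set \<Rightarrow> 'a set \<Rightarrow> bool" where
  "subuniverse F ar I J S \<longleftrightarrow> S \<subseteq> J \<and> closed_under F ar I S"

definition subalg_join ::
  "'f set \<Rightarrow> ('f \<Rightarrow> nat) \<Rightarrow> ('f \<Rightarrow> 'a list \<Rightarrow> 'a) \<Rightarrow> 'a set \<Rightarrow> 'a set \<Rightarrow> 'a set \<Rightarrow> 'a set" where
  "subalg_join F ar I J A B = subuniverse F ar I J hull (A \<union> B)"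

definition distributive_subalgebra_lattice ::
  "'f set \<Rightarrow> ('f \<Rightarrow> nat) \<Rightarrow> ('f \<Rightarrow> 'a list \<Rightarrow> 'a) \<Rightarrow> 'a set \<Rightarrow> bool" where
  "distributive_subalgebra_lattice F ar I J \<longleftrightarrow>
     (\<forall>A B C. subuniverse F ar I J A \<longrightarrow> subuniverse F ar I J B \<longrightarrow> subuniverse F ar I J C \<longrightarrow>
        A \<inter> subalg_join F ar I J B C = subalg_join F ar I J (A \<inter> B) (A \<inter> C))"

text \<open>The maximum of \<open>\<aleph>\<^sub>0\<close> and the number of symbols. The two cardinals live on different types,
  so both are transported to the sum type.\<close>

definition language_card :: "'f set \<Rightarrow> (nat + 'f) rel" where
  "language_card F =
     (if |F| \<le>o natLeq then |Inl ` (UNIV :: nat set)| else |Inr ` F| )"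

lemma subuniverse_Int:
  "subuniverse F ar I J A \<Longrightarrow> subuniverse F ar I J B \<Longrightarrow> subuniverse F ar I J (A \<inter> B)"
  by (auto simp: subuniverse_def closed_under_def)

lemma subuniverse_subalg_join:
  assumes "is_algebra F ar I J" "A \<subseteq> J" "B \<subseteq> J"
  shows "subuniverse F ar I J (subalg_join F ar I J A B)"
proof -
  have J: "subuniverse F ar I J J"
    using assms(1) by (simp add: is_algebra_def subuniverse_def)
  have "subalg_join F ar I J A B \<subseteq> J"
    unfolding subalg_join_def by (rule hull_minimal) (use assms J in auto)
  moreover have "closed_under F ar I (subalg_join F ar I J A B)"
    unfolding closed_under_def subalg_join_def hull_def
    by (fastforce simp: subuniverse_def closed_under_def in_lists_conv_set)
  ultimately show ?thesis by (simp add: subuniverse_def)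
qed

lemma subalg_join_upper: "A \<union> B \<subseteq> subalg_join F ar I J A B"
  by (simp add: subalg_join_def hull_subset)

lemma subalg_join_least:
  "subuniverse F ar I J C \<Longrightarrow> A \<subseteq> C \<Longrightarrow> B \<subseteq> C \<Longrightarrow> subalg_join F ar I J A B \<subseteq> C"
  by (simp add: subalg_join_def hull_minimal)

end

theory Submission
  imports Defs
begin

text \<open>Write \<open>\<lambda>\<close> for the cardinality of the language, \<open>\<kappa>\<close> for that of \<open>J\<close>, and \<open>\<langle>X\<rangle>\<close> for the
  subalgebra generated by \<open>X\<close>. Suppose that every proper subalgebra has fewer than \<open>\<kappa>\<close> elements.

  Well-order \<open>J\<close> and let \<open>A\<close> consist of the elements that are not generated by their predecessors.
  Since \<open>A\<close> generates \<open>J\<close>, it has more than \<open>\<lambda>\<^sup>+\<close> elements. For \<open>a \<in> A\<close>, Zorn's lemma gives a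
  subalgebra \<open>P a\<close> that contains the predecessors of \<open>a\<close> and is maximal among those missing \<open>a\<close>.

  Distributivity makes \<open>P a\<close> prime: if \<open>y \<notin> P a\<close>, then \<open>\<langle>y\<rangle> \<inter> \<langle>a\<rangle>\<close> has an element \<open>c a\<close> outside \<open>P a\<close>
  (\<open>distributive_common_witness\<close>). For fixed \<open>y\<close> these witnesses differ: if \<open>a\<close> comes before \<open>b\<close>,
  then \<open>c a \<in> \<langle>a\<rangle> \<subseteq> P b\<close> whereas \<open>c b \<notin> P b\<close>. As \<open>\<langle>y\<rangle>\<close> has at most \<open>\<lambda>\<close> elements, every \<open>y \<in> J\<close> lies
  in all but at most \<open>\<lambda>\<close> of the sets \<open>P a\<close>. But every \<open>P a\<close> is a proper subalgebra, hence smaller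
  than \<open>J\<close>, and a family of more than \<open>\<lambda>\<^sup>+\<close> sets smaller than \<open>J\<close> cannot cover \<open>J\<close> so thoroughly
  (\<open>exists_point_often_missed\<close>). This last fact is purely set-theoretic; its proof compares
  the sizes of the sets with one another, which treats regular and singular \<open>\<kappa>\<close> alike.\<close>

section \<open>Cardinal arithmetic\<close>

lemma Cinfinite_language_card: "Cinfinite (language_card F)"
proof -
  have "infinite F" if "\<not> |F| \<le>o natLeq"
    using that finite_iff_ordLess_natLeq ordLess_imp_ordLeq by blast
  then show ?thesis
    by (auto simp: language_card_def cinfinite_def Field_card_of finite_image_iff
        card_of_card_order_on)
qed

lemma card_of_symbols_le_language_card: "|F| \<le>o language_card F"
proof (cases "|F| \<le>o natLeq")
  case True
  have "natLeq =o |UNIV :: nat set|"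
    by (rule ordIso_symmetric[OF card_of_nat])
  also have "|UNIV :: nat set| =o |(Inl :: nat \<Rightarrow> nat + 'a) ` UNIV|"
    by (rule card_of_ordIsoI[of Inl]) (simp add: bij_betw_def)
  finally show ?thesis
    using True by (simp add: language_card_def ordLeq_ordIso_trans)
next
  case False
  have "|F| =o |(Inr :: 'a \<Rightarrow> nat + 'a) ` F|"
    by (rule card_of_ordIsoI[of Inr]) (simp add: bij_betw_def)
  with False show ?thesis
    by (simp add: language_card_def ordIso_imp_ordLeq)
qed

lemma card_of_le_or_greater:
  assumes "Card_order s"
  shows "|X| \<le>o s \<or> s <o |X|"
proof -
  have "Well_order s"
    using assms by (simp add: card_order_on_def)
  then show ?thesis
    using not_ordLess_iff_ordLeq[OF card_of_Well_order] by blast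
qed

lemma card_of_singleton_le:
  assumes "Cinfinite r"
  shows "|{x}| \<le>o r"
proof (rule Card_order_singl_ordLeq)
  show "Card_order r"
    using assms by simp
  show "Field r \<noteq> {}"
    using assms by (auto simp: cinfinite_def)
qed

lemma card_of_lists_of_length:
  assumes "Cinfinite r" "|C| \<le>o r"
  shows "|{xs \<in> lists C. length xs = n}| \<le>o r"
proof (induction n)
  case 0
  have "{xs \<in> lists C. length xs = 0} = {[]}"
    by auto
  then show ?case
    by (simp add: card_of_singleton_le[OF assms(1)])
next
  case (Suc n)
  let ?L = "{xs \<in> lists C. length xs = n}"
  have "{xs \<in> lists C. length xs = Suc n} = (\<Union>x\<in>C. (#) x ` ?L)"
    by (fastforce simp: length_Suc_conv)
  moreover have "|\<Union>x\<in>C. (#) x ` ?L| \<le>o r"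
    using ordLeq_transitive[OF card_of_image Suc]
    by (intro UNION_Cinfinite_bound assms ballI)
  ultimately show ?case
    by simp
qed

text \<open>A uniform bound \<open>|X|\<close> on the members is what makes this work for singular \<open>|J|\<close>: members that are
  merely each smaller than \<open>J\<close> could have union \<open>J\<close>. The union is bounded by the larger of \<open>s\<close>
  and \<open>|X|\<close>.\<close>

lemma card_of_UNION_less:
  assumes "Cinfinite s" "s <o |J|" "|X| <o |J|" "|B| \<le>o s" "\<And>b. b \<in> B \<Longrightarrow> |P b| \<le>o |X|"
  shows "|\<Union>b\<in>B. P b| <o |J|"
proof -
  consider "|X| \<le>o s" | "s \<le>o |X|"
    using assms(1) card_of_le_or_greater[of s X] ordLess_imp_ordLeq by blast
  then show ?thesis
  proof cases
    case 1
    then have "|\<Union>b\<in>B. P b| \<le>o s"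
      using assms(1,4) ordLeq_transitive[OF assms(5) 1] by (intro UNION_Cinfinite_bound) auto
    then show ?thesis
      using assms(2) by (rule ordLeq_ordLess_trans)
  next
    case 2
    then have "Cinfinite |X|"
      using assms(1) cinfinite_mono card_of_Card_order by blast
    then have "|\<Union>b\<in>B. P b| \<le>o |X|"
      using ordLeq_transitive[OF assms(4) 2] assms(5) by (intro UNION_Cinfinite_bound) auto
    then show ?thesis
      using assms(3) by (rule ordLeq_ordLess_trans)
  qed
qed

lemma exists_subset_of_card:
  assumes "Card_order s" "s \<le>o |A|"
  obtains B where "B \<subseteq> A" "|B| =o s"
proof -
  have "|Field s| \<le>o |A|"
    using assms card_of_Field_ordIso ordIso_ordLeq_trans by blast
  then obtain B where B: "B \<subseteq> A" "|Field s| =o |B|"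
    using iffD1[OF internalize_card_of_ordLeq2] by blast
  have "|B| =o s"
    using ordIso_symmetric[OF B(2)] card_of_Field_ordIso[OF assms(1)] by (rule ordIso_transitive)
  with B(1) show ?thesis
    by (rule that)
qed

text \<open>If every point of \<open>J\<close> were missed by at most \<open>r\<close> of the sets \<open>P a\<close>, then any \<open>r\<^sup>+\<close> of these sets
  would cover \<open>J\<close>, and so their sizes would have no common bound below \<open>|J|\<close>. A fixed choice \<open>B\<close> of
  \<open>r\<^sup>+\<close> indices would thus contain, for each \<open>a\<close>, some \<open>b\<close> with \<open>|P a| \<le> |P b|\<close>. With more than \<open>r\<^sup>+\<close>
  indices \<open>a\<close>, one \<open>b\<close> would serve for \<open>r\<^sup>+\<close> of them, and \<open>|P b|\<close> would be a common bound after all.\<close>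

lemma exists_point_often_missed:
  fixes A :: "'b set" and P :: "'b \<Rightarrow> 'a set" and J :: "'a set"
  assumes r: "Cinfinite r" and A: "cardSuc r <o |A|" and J: "cardSuc r <o |J|"
    and small: "\<And>a. a \<in> A \<Longrightarrow> |P a| <o |J|"
  shows "\<exists>y\<in>J. \<not> |{a \<in> A. y \<notin> P a}| \<le>o r"
proof (rule ccontr)
  assume "\<not> ?thesis"
  then have few: "|{a \<in> A. y \<notin> P a}| \<le>o r" if "y \<in> J" for y
    using that by blast
  have s: "Cinfinite (cardSuc r)"
    using r by (rule Cinfinite_cardSuc)
  have large_not_le: "\<not> |B| \<le>o r" if "|B| =o cardSuc r" for B :: "'b set"
    using that r cardSuc_greater[of r] not_ordLess_ordLeq ordIso_symmetric ordLess_ordIso_trans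
    by blast
  have unbounded: "\<exists>b\<in>B. \<not> |P b| \<le>o |X|"
    if B: "B \<subseteq> A" "|B| =o cardSuc r" and X: "|X| <o |J|" for B :: "'b set" and X :: "'a set"
  proof (rule ccontr)
    assume "\<not> ?thesis"
    then have "|\<Union>b\<in>B. P b| <o |J|"
      using card_of_UNION_less[OF s J X] B(2) ordIso_imp_ordLeq by blast
    moreover have "J \<subseteq> (\<Union>b\<in>B. P b)"
    proof
      fix y assume y: "y \<in> J"
      have "\<not> B \<subseteq> {a \<in> A. y \<notin> P a}"
        using large_not_le[OF B(2)] few[OF y] card_of_mono1 ordLeq_transitive by blast
      with B(1) show "y \<in> (\<Union>b\<in>B. P b)"
        by blast
    qed
    ultimately show False
      using card_of_mono1 not_ordLess_ordLeq by blast
  qed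
  obtain B where B: "B \<subseteq> A" "|B| =o cardSuc r"
    using exists_subset_of_card A s ordLess_imp_ordLeq by blast
  have "\<exists>b\<in>B. |P a| \<le>o |P b|" if "a \<in> A" for a
    using unbounded[OF B small[OF that]] ordLeq_total[OF card_of_Well_order card_of_Well_order]
    by blast
  then obtain f where f: "\<And>a. a \<in> A \<Longrightarrow> f a \<in> B \<and> |P a| \<le>o |P (f a)|"
    by metis
  have "\<exists>b\<in>B. \<not> |{a \<in> A. f a = b}| \<le>o cardSuc r"
  proof (rule ccontr)
    assume "\<not> ?thesis"
    then have "|\<Union>b\<in>B. {a \<in> A. f a = b}| \<le>o cardSuc r"
      using B(2) s by (intro UNION_Cinfinite_bound) (auto intro: ordIso_imp_ordLeq)
    moreover have "A \<subseteq> (\<Union>b\<in>B. {a \<in> A. f a = b})"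
      using f by blast
    ultimately have "|A| \<le>o cardSuc r"
      using card_of_mono1 ordLeq_transitive by blast
    with A show False
      by (simp add: not_ordLess_ordLeq)
  qed
  then obtain b where b: "b \<in> B" "\<not> |{a \<in> A. f a = b}| \<le>o cardSuc r"
    by blast
  then have "cardSuc r \<le>o |{a \<in> A. f a = b}|"
    using s card_of_le_or_greater[of "cardSuc r"] ordLess_imp_ordLeq by blast
  then obtain B' where B': "B' \<subseteq> {a \<in> A. f a = b}" "|B'| =o cardSuc r"
    using exists_subset_of_card s by blast
  moreover have "|P a| \<le>o |P b|" if "a \<in> B'" for a
    using that B'(1) f by blast
  ultimately show False
    using unbounded[of B' "P b"] small b(1) B(1) by blast
qed

section \<open>Generated subalgebras\<close>

locale finitary_algebra =
  fixes F :: "'f set" and ar :: "'f \<Rightarrow> nat"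
    and I :: "'f \<Rightarrow> 'a list \<Rightarrow> 'a" and J :: "'a set"
  assumes algebra: "is_algebra F ar I J"
begin

abbreviation sub :: "'a set \<Rightarrow> bool" where
  "sub \<equiv> subuniverse F ar I J"

abbreviation gen :: "'a set \<Rightarrow> 'a set" where
  "gen X \<equiv> sub hull X"

lemma sub_gen: "X \<subseteq> J \<Longrightarrow> sub (gen X)"
  using subuniverse_subalg_join[OF algebra, of X X] by (simp add: subalg_join_def)

lemma sub_Union_chain:
  assumes "\<C> \<noteq> {}" "\<And>S. S \<in> \<C> \<Longrightarrow> sub S" "\<And>S T. S \<in> \<C> \<Longrightarrow> T \<in> \<C> \<Longrightarrow> S \<subseteq> T \<or> T \<subseteq> S"
  shows "sub (\<Union>\<C>)"
proof -
  have one_member: "\<exists>S\<in>\<C>. set xs \<subseteq> S" if "set xs \<subseteq> \<Union>\<C>" for xs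
    using that
  proof (induction xs)
    case Nil
    then show ?case
      using assms(1) by auto
  next
    case (Cons x xs)
    then obtain S T where "S \<in> \<C>" "set xs \<subseteq> S" "T \<in> \<C>" "x \<in> T"
      by auto
    with assms(3)[of S T] show ?case
      by auto
  qed
  have "I f xs \<in> \<Union>\<C>" if f: "f \<in> F" and xs: "xs \<in> lists (\<Union>\<C>)" "length xs = ar f" for f xs
  proof -
    obtain S where "S \<in> \<C>" "set xs \<subseteq> S"
      using one_member[of xs] xs(1) by (auto simp: lists_eq_set)
    moreover from this have "I f xs \<in> S"
      using assms(2) f xs(2) by (auto simp: subuniverse_def closed_under_def lists_eq_set)
    ultimately show ?thesis
      by blast
  qed
  then show ?thesis
    using assms(2) by (auto simp: subuniverse_def closed_under_def)
qed

text \<open>Building the generated subalgebra from below, in countably many rounds of applying the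
  operations, is what allows its elements to be counted.\<close>

primrec stage :: "'a set \<Rightarrow> nat \<Rightarrow> 'a set" where
  "stage X 0 = X"
| "stage X (Suc n) = stage X n \<union> (\<Union>f\<in>F. I f ` {xs \<in> lists (stage X n). length xs = ar f})"

lemma gen_subset_stages:
  assumes "X \<subseteq> J"
  shows "gen X \<subseteq> (\<Union>n. stage X n)"
proof (rule hull_minimal)
  show "X \<subseteq> (\<Union>n. stage X n)"
    using stage.simps(1) by blast
  have step: "stage X n \<subseteq> stage X (Suc n)" for n
    by auto
  have in_J: "stage X n \<subseteq> J" for n
  proof (induction n)
    case (Suc n)
    then show ?case
      using algebra by (fastforce simp: is_algebra_def closed_under_def)
  qed (use assms in simp)
  have mono: "stage X m \<subseteq> stage X n" if "m \<le> n" for m n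
    using lift_Suc_mono_le[of "stage X", OF step that] .
  have "I f xs \<in> (\<Union>n. stage X n)"
    if f: "f \<in> F" and xs: "xs \<in> lists (\<Union>n. stage X n)" "length xs = ar f" for f xs
  proof -
    have one_stage: "\<exists>n. set ys \<subseteq> stage X n" if "set ys \<subseteq> (\<Union>n. stage X n)" for ys
      using that
    proof (induction ys)
      case (Cons y ys)
      then obtain m n where "set ys \<subseteq> stage X m" "y \<in> stage X n"
        by auto
      then have "set (y # ys) \<subseteq> stage X (max m n)"
        using mono[of m "max m n"] mono[of n "max m n"] by auto
      then show ?case
        by blast
    qed simp
    have "set xs \<subseteq> (\<Union>n. stage X n)"
      using xs(1) by (simp add: lists_eq_set)
    then obtain n where "set xs \<subseteq> stage X n"
      using one_stage[of xs] by blast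
    then have "I f xs \<in> stage X (Suc n)"
      using f xs(2) by (auto simp: in_lists_conv_set)
    then show ?thesis
      by blast
  qed
  with in_J show "sub (\<Union>n. stage X n)"
    by (auto simp: subuniverse_def closed_under_def)
qed

lemma card_of_gen:
  assumes r: "Cinfinite r" and F: "|F| \<le>o r" and X: "|X| \<le>o r" "X \<subseteq> J"
  shows "|gen X| \<le>o r"
proof -
  have "|stage X n| \<le>o r" for n
  proof (induction n)
    case (Suc n)
    have "|\<Union>f\<in>F. I f ` {xs \<in> lists (stage X n). length xs = ar f}| \<le>o r"
      using r F card_of_lists_of_length[OF r Suc] ordLeq_transitive[OF card_of_image]
      by (intro UNION_Cinfinite_bound) auto
    with Suc show ?case
      using r by (simp add: Un_Cinfinite_bound)
  qed (use X in simp)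
  moreover have "|UNIV :: nat set| \<le>o r"
    using r infinite_iff_card_of_nat card_of_Field_ordIso
    by (metis cinfinite_def ordLeq_ordIso_trans)
  ultimately have "|\<Union>n. stage X n| \<le>o r"
    using r by (intro UNION_Cinfinite_bound) auto
  then show ?thesis
    using card_of_mono1[OF gen_subset_stages[OF X(2)]] ordLeq_transitive by blast
qed

section \<open>Subalgebras that are maximal without a given element\<close>

definition maximal_missing :: "'a \<Rightarrow> 'a set \<Rightarrow> bool" where
  "maximal_missing a P \<longleftrightarrow> sub P \<and> a \<notin> P \<and> (\<forall>Q. sub Q \<longrightarrow> P \<subset> Q \<longrightarrow> a \<in> Q)"

lemma exists_maximal_missing:
  assumes "sub S" "a \<notin> S"
  shows "\<exists>P. S \<subseteq> P \<and> maximal_missing a P"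
proof -
  let ?\<A> = "{P. sub P \<and> S \<subseteq> P \<and> a \<notin> P}"
  have "\<exists>M\<in>?\<A>. \<forall>X\<in>?\<A>. M \<subseteq> X \<longrightarrow> X = M"
  proof (rule subset_Zorn_nonempty)
    show "?\<A> \<noteq> {}"
      using assms by blast
    fix \<C> assume ne: "\<C> \<noteq> {}" and chain: "subset.chain ?\<A> \<C>"
    have "sub (\<Union>\<C>)"
      using ne chain by (intro sub_Union_chain) (auto simp: subset_chain_def)
    then show "\<Union>\<C> \<in> ?\<A>"
      using ne chain by (auto simp: subset_chain_def)
  qed
  then obtain M where "sub M" "S \<subseteq> M" "a \<notin> M"
    and max: "\<And>X. sub X \<Longrightarrow> S \<subseteq> X \<Longrightarrow> a \<notin> X \<Longrightarrow> M \<subseteq> X \<Longrightarrow> X = M"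
    by auto
  moreover have "a \<in> Q" if "sub Q" "M \<subset> Q" for Q
    using max[of Q] that \<open>S \<subseteq> M\<close> by auto
  ultimately show ?thesis
    by (auto simp: maximal_missing_def)
qed

text \<open>By maximality \<open>a\<close> lies in the join of \<open>P\<close> and \<open>gen {y}\<close>. Intersecting with \<open>gen {a}\<close> and
  distributing, \<open>a\<close> lies in the join of \<open>gen {a} \<inter> P\<close> and \<open>gen {a} \<inter> gen {y}\<close>; were the second
  part contained in \<open>P\<close> like the first, \<open>P\<close> would contain \<open>a\<close>.\<close>

lemma distributive_common_witness:
  assumes distrib: "distributive_subalgebra_lattice F ar I J"
    and P: "maximal_missing a P" and a: "a \<in> J" and y: "y \<in> J" "y \<notin> P"
  shows "\<exists>c. c \<in> gen {y} \<and> c \<in> gen {a} \<and> c \<notin> P"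
proof (rule ccontr)
  assume no_witness: "\<not> ?thesis"
  let ?join = "subalg_join F ar I J"
  have subs: "sub P" "sub (gen {a})" "sub (gen {y})"
    using P a y sub_gen by (auto simp: maximal_missing_def)
  then have "P \<subseteq> J" "gen {y} \<subseteq> J"
    by (auto simp: subuniverse_def)
  then have "sub (?join P (gen {y}))"
    by (rule subuniverse_subalg_join[OF algebra])
  moreover have "P \<subset> ?join P (gen {y})"
    using subalg_join_upper[of P "gen {y}" F ar I J] hull_inc[of y "{y}" sub] y(2) by blast
  ultimately have "a \<in> ?join P (gen {y})"
    using P by (auto simp: maximal_missing_def)
  then have "a \<in> gen {a} \<inter> ?join P (gen {y})"
    by (simp add: hull_inc)
  also have "\<dots> = ?join (gen {a} \<inter> P) (gen {a} \<inter> gen {y})"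
    using distrib subs by (simp add: distributive_subalgebra_lattice_def)
  also have "\<dots> \<subseteq> P"
    using no_witness by (intro subalg_join_least[OF subs(1)]) auto
  finally show False
    using P by (simp add: maximal_missing_def)
qed

section \<open>A large irredundant generating set\<close>

text \<open>The relation \<open>w\<close> is meant as a strict well-order of the elements.\<close>

definition irredundant :: "'a rel \<Rightarrow> 'a set" where
  "irredundant w = {j \<in> J. j \<notin> gen {i \<in> J. (i, j) \<in> w}}"

lemma gen_irredundant:
  assumes "wf w"
  shows "J \<subseteq> gen (irredundant w)"
proof
  fix j assume "j \<in> J"
  with assms show "j \<in> gen (irredundant w)"
  proof (induction j rule: wf_induct_rule)
    case (less j)
    have "sub (gen (irredundant w))"
      by (rule sub_gen) (auto simp: irredundant_def)
    then have "gen {i \<in> J. (i, j) \<in> w} \<subseteq> gen (irredundant w)"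
      using less.IH by (intro hull_minimal) auto
    then show ?case
      using less.prems hull_inc[of j "irredundant w" sub] by (auto simp: irredundant_def)
  qed
qed

end

section \<open>The theorem\<close>

theorem theorem2p4:
  fixes F :: "'f set" and ar :: "'f \<Rightarrow> nat"
    and I :: "'f \<Rightarrow> 'a list \<Rightarrow> 'a" and J :: "'a set"
  assumes "is_algebra F ar I J"
    and "cardSuc (language_card F) <o |J|"
    and "distributive_subalgebra_lattice F ar I J"
  shows "\<exists>S. subuniverse F ar I J S \<and> S \<noteq> J \<and> |S| =o |J|"
proof (rule ccontr)
  assume no_large: "\<not> ?thesis"
  interpret finitary_algebra F ar I J
    by unfold_locales (rule assms(1))
  define l where "l = language_card F"
  have l: "Cinfinite l" "|F| \<le>o l" "cardSuc l <o |J|"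
    using assms(2) by (simp_all add: l_def Cinfinite_language_card card_of_symbols_le_language_card)
  have small: "|S| <o |J|" if "sub S" "S \<noteq> J" for S
    using that no_large card_of_mono1[of S J] ordLeq_iff_ordLess_or_ordIso
    by (auto simp: subuniverse_def)
  obtain w0 :: "'a rel" where w0: "well_order_on UNIV w0"
    using well_order_on by blast
  define w where "w = w0 - Id"
  have wf: "wf w" and total: "\<And>a b. a \<noteq> b \<Longrightarrow> (a, b) \<in> w \<or> (b, a) \<in> w"
    using w0 by (auto simp: w_def well_order_on_def linear_order_on_def total_on_def)
  define A where "A = irredundant w"
  have A_sub: "A \<subseteq> J"
    by (auto simp: A_def irredundant_def)
  \<comment> \<open>A generating set of size at most \<open>\<lambda>\<^sup>+\<close> would generate at most \<open>\<lambda>\<^sup>+\<close> elements.\<close>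
  have A_large: "cardSuc l <o |A|"
  proof (rule ccontr)
    assume "\<not> cardSuc l <o |A|"
    then have "|A| \<le>o cardSuc l"
      using l(1) Cinfinite_cardSuc[of l] card_of_le_or_greater[of "cardSuc l" A] by blast
    moreover have "|F| \<le>o cardSuc l"
      using l cardSuc_ordLeq ordLeq_transitive by blast
    ultimately have "|gen A| \<le>o cardSuc l"
      using card_of_gen Cinfinite_cardSuc[OF l(1)] A_sub by blast
    then have "|J| \<le>o cardSuc l"
      using card_of_mono1[OF gen_irredundant[OF wf]] ordLeq_transitive by (auto simp: A_def)
    then show False
      using l(3) not_ordLess_ordLeq by blast
  qed
  have "\<exists>P. gen {i \<in> J. (i, a) \<in> w} \<subseteq> P \<and> maximal_missing a P" if "a \<in> A" for a
    using that by (intro exists_maximal_missing sub_gen) (auto simp: A_def irredundant_def)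
  then obtain P where earlier: "\<And>a. a \<in> A \<Longrightarrow> gen {i \<in> J. (i, a) \<in> w} \<subseteq> P a"
    and P: "\<And>a. a \<in> A \<Longrightarrow> maximal_missing a (P a)"
    by metis
  have P_small: "|P a| <o |J|" if "a \<in> A" for a
    using P[OF that] that A_sub by (intro small) (auto simp: maximal_missing_def)
  have "|{a \<in> A. y \<notin> P a}| \<le>o l" if y: "y \<in> J" for y
  proof -
    let ?N = "{a \<in> A. y \<notin> P a}"
    have "\<exists>c. c \<in> gen {y} \<and> c \<in> gen {a} \<and> c \<notin> P a" if "a \<in> ?N" for a
      using that distributive_common_witness[OF assms(3) P] y A_sub by blast
    then obtain c where c: "\<And>a. a \<in> ?N \<Longrightarrow> c a \<in> gen {y} \<and> c a \<in> gen {a} \<and> c a \<notin> P a"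
      by metis
    have distinct: "c a \<noteq> c b" if a: "a \<in> ?N" and b: "b \<in> ?N" and ab: "(a, b) \<in> w" for a b
    proof -
      have "gen {a} \<subseteq> gen {i \<in> J. (i, b) \<in> w}"
        using a ab A_sub by (intro hull_mono) auto
      then show ?thesis
        using c[OF a] c[OF b] earlier[of b] b by auto
    qed
    with total have "inj_on c ?N"
      by (metis (no_types, lifting) inj_onI)
    then have "|?N| \<le>o |gen {y}|"
      using c card_of_ordLeq[of ?N "gen {y}"] by blast
    moreover have "|gen {y}| \<le>o l"
      using l y by (intro card_of_gen card_of_singleton_le) auto
    ultimately show ?thesis
      by (rule ordLeq_transitive)
  qed
  with exists_point_often_missed[of l A J P, OF l(1) A_large l(3) P_small] show False
    by blast
qed

end
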